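(* Consider the centralized market-clearing problem and the market equilibrium problem defined in the context, and let $\pi^{\mathrm{mo}}_\omega=\pi^{\mathrm p}_\omega=\pi^{\mathrm c}_\omega$ for all $\omega\in\Omega$. Then there exists a set of prices $\{\tilde\lambda^\star_\omega\}_{\omega\in\Omega}$ that yields the optimal solution $p^\star,d^\star,\{r^\star_\omega,l^\star_\omega\}_{\omega\in\Omega}$ in the equilibrium problem (that is, together with these prices it is a solution of the equilibrium problem) that solves the centralized problem. Moreover, $\tilde\lambda^\star_\omega=\lambda^\star_\omega$ for all $\omega\in\Omega$, where $\{\lambda^\star_\omega\}_{\omega\in\Omega}$ are the optimal dual prices of the power balance constraints in the centralized problem.
   Context: $\Omega$ is a finite nonempty set of outcomes and $\xi_\omega\in\mathbb{R}$ is the renewable power output in outcome $\omega\in\Omega$. The producer's variables are a day-ahead dispatch $p\in\mathbb{R}$ and real-time adjustments $r_\omega\in\mathbb{R}$, with $(p,r_\omega)\in\mathcal{O}$ for all $\omega$. The consumer's variables are a day-ahead demand $d\in\mathbb{R}$ and real-time adjustments $l_\omega\in\mathbb{R}$, with $(d,l_\omega)\in\mathcal{K}$ for all $\omega$. The sets $\mathcal{O},\mathcal{K}\subset\mathbb{R}^2$ are nonempty, convex and compact. The cost function is $c(x)=\tfrac12\alpha x^2$ and the utility function is $u(x)=\gamma x-\tfrac12\beta x^2$, where $\alpha,\beta,\gamma>0$ are constants. The market operator, the producer and the consumer have probability vectors $(\pi^{\mathrm{mo}}_\omega)_{\omega}$, $(\pi^{\mathrm p}_\omega)_{\omega}$,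 $(\pi^{\mathrm c}_\omega)_{\omega}$ on $\Omega$, respectively, with positive entries. Centralized problem: $$\max_{p,r_\omega,d,l_\omega}\ [u(d)-c(p)]+\sum_{\omega\in\Omega}\pi^{\mathrm{mo}}_\omega[u(l_\omega)-c(r_\omega)]$$ subject to $p+r_\omega+\xi_\omega-d-l_\omega\ge 0$ with dual price (Lagrange multiplier) $\lambda_\omega\ge 0$, for all $\omega\in\Omega$ (the power balance constraints), and $(p,r_\omega)\in\mathcal{O}$, $(d,l_\omega)\in\mathcal{K}$ for all $\omega\in\Omega$. Standing assumption on prices: the dual prices $\lambda_\omega$ of the centralized problem and the equilibrium prices $\tilde\lambda_\omega$ both belong to a compact convex set $\Lambda_+$ of non-negative reals containing $0$. In particular, optimal dual prices $\lambda^\star_\omega$ exist and lie in $\Lambda_+$. The equilibrium problem consists of the following simultaneous optimization problems, in which each agent takes the variables of the other agents as given: - price-setter, for each $\omega\in\Omega$: $\max_{\tilde\lambda_\omega\in\Lambda_+} -\tilde\lambda_\omega\,[p+r_\omega+\xi_\omega-d-l_\omega]$; - producer: $\max_{(p,r_\omega)\in\mathcal{O}\ \forall\omega} \sum_{\omega\in\Omega}\pi^{\mathrm p}_\omega\Big[\frac{\tilde\lambda_\omega}{\pi^{\mathrm p}_\omega}(p+r_\omega)-c(r_\omega)\Big]-c(p)$; - consumer: $\max_{(d,l_\omega)\in\mathcal{K}\ \forall\omega} \sum_{\omega\in\Omega}\pi^{\mathrm c}_\omega\Big[u(l_\omega)-\frac{\tilde\lambda_\omega}{\pi^{\mathrm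 c}_\omega}(d+l_\omega)\Big]+u(d)$. A solution of the equilibrium problem is a tuple $(p,(r_\omega)_\omega,d,(l_\omega)_\omega,(\tilde\lambda_\omega)_\omega)$ such that each agent's own variables are optimal in its own problem given the other agents' variables. *)

theory Defs
  imports "HOL-Analysis.Analysis"
begin

definition cost :: "real \<Rightarrow> real \<Rightarrow> real" where
  "cost \<alpha> x = 1/2 * \<alpha> * x^2"

definition utility :: "real \<Rightarrow> real \<Rightarrow> real \<Rightarrow> real" where
  "utility \<beta> \<gamma> x = \<gamma> * x - 1/2 * \<beta> * x^2"

definition probability_vector :: "('w::finite \<Rightarrow> real) \<Rightarrow> bool" where
  "probability_vector \<pi> \<longleftrightarrow> (\<forall>w. 0 < \<pi> w) \<and> (\<Sum>w\<in>UNIV. \<pi> w) = 1"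

definition power_balance ::
  "('w \<Rightarrow> real) \<Rightarrow> real \<Rightarrow> ('w \<Rightarrow> real) \<Rightarrow> real \<Rightarrow> ('w \<Rightarrow> real) \<Rightarrow> 'w \<Rightarrow> real" where
  "power_balance \<xi> p r d l w = p + r w + \<xi> w - d - l w"

definition dispatchable :: "(real \<times> real) set \<Rightarrow> real \<times> ('w \<Rightarrow> real) \<Rightarrow> bool" where
  "dispatchable S = (\<lambda>(x, y). \<forall>w. (x, y w) \<in> S)"

text \<open>Joint decisions are tuples (p, r, d, l).\<close>

definition social_welfare ::
  "real \<Rightarrow> real \<Rightarrow> real \<Rightarrow> ('w::finite \<Rightarrow> real)
    \<Rightarrow> real \<times> ('w \<Rightarrow> real) \<times> real \<times> ('w \<Rightarrow> real) \<Rightarrow> real" where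
  "social_welfare \<alpha> \<beta> \<gamma> \<pi> = (\<lambda>(p, r, d, l).
     (utility \<beta> \<gamma> d - cost \<alpha> p)
     + (\<Sum>w\<in>UNIV. \<pi> w * (utility \<beta> \<gamma> (l w) - cost \<alpha> (r w))))"

definition jointly_dispatchable ::
  "(real \<times> real) set \<Rightarrow> (real \<times> real) set
    \<Rightarrow> real \<times> ('w \<Rightarrow> real) \<times> real \<times> ('w \<Rightarrow> real) \<Rightarrow> bool" where
  "jointly_dispatchable \<O> \<K> = (\<lambda>(p, r, d, l).
     dispatchable \<O> (p, r) \<and> dispatchable \<K> (d, l))"

definition centralized_feasible ::
  "(real \<times> real) set \<Rightarrow> (real \<times> real) set \<Rightarrow> ('w \<Rightarrow> real)
    \<Rightarrow> real \<times> ('w \<Rightarrow> real) \<times> real \<times> ('w \<Rightarrow> real) \<Rightarrow> bool" where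
  "centralized_feasible \<O> \<K> \<xi> = (\<lambda>(p, r, d, l).
     jointly_dispatchable \<O> \<K> (p, r, d, l) \<and> (\<forall>w. power_balance \<xi> p r d l w \<ge> 0))"

definition centralized_solution ::
  "real \<Rightarrow> real \<Rightarrow> real \<Rightarrow> (real \<times> real) set \<Rightarrow> (real \<times> real) set \<Rightarrow> ('w::finite \<Rightarrow> real)
    \<Rightarrow> ('w \<Rightarrow> real) \<Rightarrow> real \<times> ('w \<Rightarrow> real) \<times> real \<times> ('w \<Rightarrow> real) \<Rightarrow> bool" where
  "centralized_solution \<alpha> \<beta> \<gamma> \<O> \<K> \<xi> \<pi> =
     is_arg_max (social_welfare \<alpha> \<beta> \<gamma> \<pi>) (centralized_feasible \<O> \<K> \<xi>)"

definition lagrangian ::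
  "real \<Rightarrow> real \<Rightarrow> real \<Rightarrow> ('w::finite \<Rightarrow> real) \<Rightarrow> ('w \<Rightarrow> real) \<Rightarrow> ('w \<Rightarrow> real)
    \<Rightarrow> real \<times> ('w \<Rightarrow> real) \<times> real \<times> ('w \<Rightarrow> real) \<Rightarrow> real" where
  "lagrangian \<alpha> \<beta> \<gamma> \<xi> \<pi> lam = (\<lambda>(p, r, d, l).
     social_welfare \<alpha> \<beta> \<gamma> \<pi> (p, r, d, l) + (\<Sum>w\<in>UNIV. lam w * power_balance \<xi> p r d l w))"

text \<open>Only the power balance constraints are dualized. For nonempty compact \<open>\<O>\<close> and \<open>\<K>\<close> the
  supremum is taken over a nonempty set that is bounded above, so it is a genuine one.\<close>

definition dual_function ::
  "real \<Rightarrow> real \<Rightarrow> real \<Rightarrow> (real \<times> real) set \<Rightarrow> (real \<times> real) set \<Rightarrow> ('w::finite \<Rightarrow> real)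
    \<Rightarrow> ('w \<Rightarrow> real) \<Rightarrow> ('w \<Rightarrow> real) \<Rightarrow> real" where
  "dual_function \<alpha> \<beta> \<gamma> \<O> \<K> \<xi> \<pi> lam =
     (SUP x\<in>Collect (jointly_dispatchable \<O> \<K>). lagrangian \<alpha> \<beta> \<gamma> \<xi> \<pi> lam x)"

definition optimal_dual_prices ::
  "real \<Rightarrow> real \<Rightarrow> real \<Rightarrow> (real \<times> real) set \<Rightarrow> (real \<times> real) set \<Rightarrow> ('w::finite \<Rightarrow> real)
    \<Rightarrow> ('w \<Rightarrow> real) \<Rightarrow> ('w \<Rightarrow> real) \<Rightarrow> bool" where
  "optimal_dual_prices \<alpha> \<beta> \<gamma> \<O> \<K> \<xi> \<pi> =
     is_arg_min (dual_function \<alpha> \<beta> \<gamma> \<O> \<K> \<xi> \<pi>) (\<lambda>lam. \<forall>w. 0 \<le> lam w)"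

definition producer_objective ::
  "real \<Rightarrow> ('w::finite \<Rightarrow> real) \<Rightarrow> ('w \<Rightarrow> real) \<Rightarrow> real \<times> ('w \<Rightarrow> real) \<Rightarrow> real" where
  "producer_objective \<alpha> \<pi> lam = (\<lambda>(p, r).
     (\<Sum>w\<in>UNIV. \<pi> w * (lam w / \<pi> w * (p + r w) - cost \<alpha> (r w))) - cost \<alpha> p)"

definition consumer_objective ::
  "real \<Rightarrow> real \<Rightarrow> ('w::finite \<Rightarrow> real) \<Rightarrow> ('w \<Rightarrow> real) \<Rightarrow> real \<times> ('w \<Rightarrow> real) \<Rightarrow> real" where
  "consumer_objective \<beta> \<gamma> \<pi> lam = (\<lambda>(d, l).
     (\<Sum>w\<in>UNIV. \<pi> w * (utility \<beta> \<gamma> (l w) - lam w / \<pi> w * (d + l w))) + utility \<beta> \<gamma> d)"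

definition equilibrium_solution ::
  "real \<Rightarrow> real \<Rightarrow> real \<Rightarrow> (real \<times> real) set \<Rightarrow> (real \<times> real) set \<Rightarrow> real set
    \<Rightarrow> ('w::finite \<Rightarrow> real) \<Rightarrow> ('w \<Rightarrow> real) \<Rightarrow> ('w \<Rightarrow> real)
    \<Rightarrow> real \<times> ('w \<Rightarrow> real) \<times> real \<times> ('w \<Rightarrow> real) \<Rightarrow> ('w \<Rightarrow> real) \<Rightarrow> bool" where
  "equilibrium_solution \<alpha> \<beta> \<gamma> \<O> \<K> \<Lambda> \<xi> \<pi>p \<pi>c = (\<lambda>(p, r, d, l) lam.
     (\<forall>w. is_arg_max (\<lambda>m. - m * power_balance \<xi> p r d l w) (\<lambda>m. m \<in> \<Lambda>) (lam w)) \<and>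
     is_arg_max (producer_objective \<alpha> \<pi>p lam) (dispatchable \<O>) (p, r) \<and>
     is_arg_max (consumer_objective \<beta> \<gamma> \<pi>c lam) (dispatchable \<K>) (d, l))"

end

theory Submission imports Defs begin

text \<open>
  Since cost is strictly convex and utility strictly concave, the Lagrangian has a unique
  maximiser \<open>x\<^sub>0\<close> at optimal dual prices \<open>\<lambda>\<close>. By Danskin's argument the dual function is therefore
  differentiable at \<open>\<lambda>\<close>, with gradient the power balance at \<open>x\<^sub>0\<close>; minimality of \<open>\<lambda>\<close> over the
  nonnegative orthant then says that \<open>x\<^sub>0\<close> is feasible and satisfies complementary slackness, without
  any constraint qualification. So \<open>x\<^sub>0\<close> is the only solution of the centralized problem. As the
  Lagrangian splits into the producer's and the consumer's objectives plus a constant, \<open>x\<^sub>0\<close>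
  and \<open>\<lambda>\<close> form an equilibrium.
\<close>

section \<open>A directional Danskin argument\<close>

text \<open>Perturbations of size \<open>t n\<close> tending to 0 supply points \<open>x n\<close>;
  maximality of \<open>h x0\<close> forces \<open>k\<close> to be nonnegative at each of them. By
  compactness they cluster at some \<open>y\<close>, and since the perturbation term vanishes in the
  limit, \<open>y\<close> maximises \<open>h\<close> and so equals \<open>x0\<close>. Continuity
  then carries the sign of \<open>k\<close> over to \<open>x0\<close>.\<close>

lemma unique_maximizer_directional:
  fixes h k :: "'a::metric_space \<Rightarrow> real"
  assumes "compact X" and cont: "continuous_on X h" "continuous_on X k"
    and max: "\<And>x. x \<in> X \<Longrightarrow> h x \<le> h x0"
    and unique: "\<And>x. x \<in> X \<Longrightarrow> h x0 \<le> h x \<Longrightarrow> x = x0"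
    and "\<delta> > 0"
    and perturb: "\<And>t. 0 < t \<Longrightarrow> t \<le> \<delta> \<Longrightarrow> \<exists>x\<in>X. h x0 \<le> h x + t * k x"
  shows "0 \<le> k x0"
proof -
  define t where "t n = \<delta> / real (Suc n)" for n
  have t: "0 < t n" "t n \<le> \<delta>" for n
    using \<open>\<delta> > 0\<close> by (auto simp: t_def field_simps)
  have "\<forall>n. \<exists>x\<in>X. h x0 \<le> h x + t n * k x"
    using perturb t by blast
  then obtain x where x: "\<And>n. x n \<in> X" "\<And>n. h x0 \<le> h (x n) + t n * k (x n)"
    by metis
  have k_nonneg: "0 \<le> k (x n)" for n
    using x(2)[of n] max[OF x(1)[of n]] t(1)[of n]
    by (smt (verit) mult_pos_neg)
  obtain y \<sigma> where y: "y \<in> X" "strict_mono \<sigma>" "(x \<circ> \<sigma>) \<longlonglongrightarrow> y"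
    using \<open>compact X\<close> x(1) unfolding compact_eq_seq_compact_metric seq_compact_def by blast
  have hk: "(\<lambda>n. h (x (\<sigma> n))) \<longlonglongrightarrow> h y" "(\<lambda>n. k (x (\<sigma> n))) \<longlonglongrightarrow> k y"
    using cont y(1,3) x(1) by (auto simp: continuous_on_sequentially comp_def)
  have "t \<longlonglongrightarrow> 0"
    unfolding t_def using LIMSEQ_Suc[OF lim_const_over_n] by simp
  then have "(\<lambda>n. t (\<sigma> n)) \<longlonglongrightarrow> 0"
    using LIMSEQ_subseq_LIMSEQ[OF _ y(2)] by (auto simp: comp_def)
  \<comment> \<open>\<open>k\<close> converges along the subsequence, so its product with the null
    sequence drops out of the limit.\<close>
  then have "(\<lambda>n. h (x (\<sigma> n)) + t (\<sigma> n) * k (x (\<sigma> n))) \<longlonglongrightarrow> h y + 0 * k y"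
    by (intro tendsto_intros hk)
  then have "h x0 \<le> h y"
    using x(2) by (auto intro: LIMSEQ_le_const)
  then have "y = x0"
    using unique y(1) by blast
  then show ?thesis
    using hk(2) k_nonneg by (auto intro: LIMSEQ_le_const)
qed

section \<open>Compactness of the decision sets and attainment of the dual supremum\<close>

text \<open>In the product topology on functions, the set is a closed part of a compact box: the
  projection \<open>fst\<close> S\<open>times one copy of\<close>snd \<open>S\<close> per outcome,
  which is compact by Tychonoff. Each outcome contributes one closed condition, the preimage of
  \<open>S\<close> under a continuous map.\<close>

lemma dispatchable_compact:
  fixes S :: "(real \<times> real) set"
  assumes "compact S"
  shows "compact (Collect (dispatchable S) :: (real \<times> ('w::finite \<Rightarrow> real)) set)"
proof -
  have box: "compact (UNIV \<rightarrow>\<^sub>E snd ` S :: ('w \<Rightarrow> real) set)"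
  proof -
    have "compactin (product_topology (\<lambda>_::'w. euclidean) UNIV) (UNIV \<rightarrow>\<^sub>E snd ` S)"
      using assms by (auto simp: compactin_PiE intro!: compact_continuous_image continuous_intros)
    then show ?thesis
      by (simp add: euclidean_product_topology)
  qed
  have "closed ((\<lambda>z :: real \<times> ('w \<Rightarrow> real). (fst z, snd z w)) -` S)" for w
    by (intro closed_vimage compact_imp_closed assms continuous_intros
        continuous_on_product_then_coordinatewise)
  then have "closed (\<Inter>w. (\<lambda>z :: real \<times> ('w \<Rightarrow> real). (fst z, snd z w)) -` S)"
    by blast
  moreover have "compact (fst ` S \<times> (UNIV \<rightarrow>\<^sub>E snd ` S :: ('w \<Rightarrow> real) set))"
    using assms by (intro compact_Times box compact_continuous_image continuous_intros)
  ultimately have "compact ((fst ` S \<times> (UNIV \<rightarrow>\<^sub>E snd ` S)) \<inter>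
      (\<Inter>w. (\<lambda>z :: real \<times> ('w \<Rightarrow> real). (fst z, snd z w)) -` S))"
    by (rule compact_Int_closed[rotated])
  also have "(fst ` S \<times> (UNIV \<rightarrow>\<^sub>E snd ` S)) \<inter>
      (\<Inter>w. (\<lambda>z :: real \<times> ('w \<Rightarrow> real). (fst z, snd z w)) -` S) = Collect (dispatchable S)"
    by (force simp: dispatchable_def)
  finally show ?thesis .
qed

lemma jointly_dispatchable_compact:
  assumes "compact \<O>" "compact \<K>"
  shows "compact (Collect (jointly_dispatchable \<O> \<K>) ::
    (real \<times> ('w::finite \<Rightarrow> real) \<times> real \<times> ('w \<Rightarrow> real)) set)"
proof -
  \<comment> \<open>Up to a continuous rebracketing of tuples, this is the product of the two
    agents' sets.\<close>
  have "Collect (jointly_dispatchable \<O> \<K>) = (\<lambda>((p, r), (d, l)). (p, r, d, l)) `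
      ((Collect (dispatchable \<O>) :: (real \<times> ('w \<Rightarrow> real)) set) \<times> Collect (dispatchable \<K>))"
    by (force simp: jointly_dispatchable_def)
  also have "compact \<dots>"
    unfolding split_def
    by (intro compact_continuous_image continuous_intros compact_Times dispatchable_compact assms)
  finally show ?thesis .
qed

lemma jointly_dispatchable_nonempty:
  assumes "\<O> \<noteq> {}" "\<K> \<noteq> {}"
  shows "Collect (jointly_dispatchable \<O> \<K>) \<noteq> {}"
proof -
  obtain a b c e where "(a, b) \<in> \<O>" "(c, e) \<in> \<K>"
    using assms by (metis ex_in_conv surj_pair)
  then have "jointly_dispatchable \<O> \<K> (a, \<lambda>_. b, c, \<lambda>_. e)"
    by (simp add: jointly_dispatchable_def dispatchable_def)
  then show ?thesis by blast
qed

lemma continuous_on_power_balance: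
  "continuous_on X (\<lambda>(p, r, d, l). power_balance \<xi> p r d l w)"
  unfolding power_balance_def split_def
  by (intro continuous_intros continuous_on_product_then_coordinatewise)

lemma continuous_on_lagrangian:
  "continuous_on X (lagrangian \<alpha> \<beta> \<gamma> \<xi> \<pi> lam)"
  unfolding lagrangian_def social_welfare_def utility_def cost_def power_balance_def split_def
  by (intro continuous_intros continuous_on_product_then_coordinatewise)

text \<open>Replaces the supremum in \<open>dual_function\<close> by the value at an actual
  maximiser, at arbitrary prices.\<close>

lemma lagrangian_attains_max:
  fixes \<xi> \<pi> lam :: "'w::finite \<Rightarrow> real"
  assumes "compact \<O>" "compact \<K>" "\<O> \<noteq> {}" "\<K> \<noteq> {}"
  obtains x where "jointly_dispatchable \<O> \<K> x"
    "\<And>y. jointly_dispatchable \<O> \<K> y \<Longrightarrow>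
      lagrangian \<alpha> \<beta> \<gamma> \<xi> \<pi> lam y \<le> lagrangian \<alpha> \<beta> \<gamma> \<xi> \<pi> lam x"
    "dual_function \<alpha> \<beta> \<gamma> \<O> \<K> \<xi> \<pi> lam = lagrangian \<alpha> \<beta> \<gamma> \<xi> \<pi> lam x"
proof -
  obtain x where x: "jointly_dispatchable \<O> \<K> x"
    "\<And>y. jointly_dispatchable \<O> \<K> y \<Longrightarrow>
      lagrangian \<alpha> \<beta> \<gamma> \<xi> \<pi> lam y \<le> lagrangian \<alpha> \<beta> \<gamma> \<xi> \<pi> lam x"
    using continuous_attains_sup[OF jointly_dispatchable_compact[OF assms(1,2)]
        jointly_dispatchable_nonempty[OF assms(3,4)] continuous_on_lagrangian[of _ \<alpha> \<beta> \<gamma> \<xi> \<pi> lam]]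
    by auto
  then have "dual_function \<alpha> \<beta> \<gamma> \<O> \<K> \<xi> \<pi> lam = lagrangian \<alpha> \<beta> \<gamma> \<xi> \<pi> lam x"
    unfolding dual_function_def by (intro cSup_eq_maximum) auto
  with x that show thesis by blast
qed

section \<open>Uniqueness of the maximiser of the Lagrangian\<close>

lemma convex_midpoint_mem:
  fixes S :: "(real \<times> real) set"
  assumes "convex S" "(a, b) \<in> S" "(c, e) \<in> S"
  shows "((a + c) / 2, (b + e) / 2) \<in> S"
  using convexD[OF assms, of "1/2" "1/2"] by (simp add: add_divide_distrib)

text \<open>Cost and utility are quadratic, so the gap of midpoint concavity is an exact sum of
  squares (half the curvature times a quarter of the squared difference, hence the 8). The price
  terms are affine and leave no gap.\<close>

lemma lagrangian_midpoint:
  "lagrangian \<alpha> \<beta> \<gamma> \<xi> \<pi> lam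
      ((p + p') / 2, \<lambda>w. (r w + r' w) / 2, (d + d') / 2, \<lambda>w. (l w + l' w) / 2) =
    (lagrangian \<alpha> \<beta> \<gamma> \<xi> \<pi> lam (p, r, d, l) + lagrangian \<alpha> \<beta> \<gamma> \<xi> \<pi> lam (p', r', d', l')) / 2
    + (\<alpha> * (p - p')\<^sup>2 + \<beta> * (d - d')\<^sup>2
       + (\<Sum>w\<in>UNIV. \<pi> w * (\<alpha> * (r w - r' w)\<^sup>2 + \<beta> * (l w - l' w)\<^sup>2))) / 8"
proof -
  have u: "utility \<beta> \<gamma> ((x + y) / 2) =
      (utility \<beta> \<gamma> x + utility \<beta> \<gamma> y) / 2 + \<beta> * (x - y)\<^sup>2 / 8" for x y
    by (simp add: utility_def field_simps power2_eq_square)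
  have c: "cost \<alpha> ((x + y) / 2) = (cost \<alpha> x + cost \<alpha> y) / 2 - \<alpha> * (x - y)\<^sup>2 / 8" for x y
    by (simp add: cost_def field_simps power2_eq_square)
  have b: "power_balance \<xi> ((p + p') / 2) (\<lambda>w. (r w + r' w) / 2) ((d + d') / 2)
        (\<lambda>w. (l w + l' w) / 2) w =
      (power_balance \<xi> p r d l w + power_balance \<xi> p' r' d' l' w) / 2" for w
    by (simp add: power_balance_def field_simps)
  have s: "(\<Sum>w\<in>UNIV. \<pi> w * ((utility \<beta> \<gamma> (l w) + utility \<beta> \<gamma> (l' w)) / 2 + \<beta> * (l w - l' w)\<^sup>2 / 8
        - ((cost \<alpha> (r w) + cost \<alpha> (r' w)) / 2 - \<alpha> * (r w - r' w)\<^sup>2 / 8))) =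
      ((\<Sum>w\<in>UNIV. \<pi> w * (utility \<beta> \<gamma> (l w) - cost \<alpha> (r w)))
       + (\<Sum>w\<in>UNIV. \<pi> w * (utility \<beta> \<gamma> (l' w) - cost \<alpha> (r' w)))) / 2
      + (\<Sum>w\<in>UNIV. \<pi> w * (\<alpha> * (r w - r' w)\<^sup>2 + \<beta> * (l w - l' w)\<^sup>2)) / 8"
    unfolding sum.distrib[symmetric] sum_divide_distrib
    by (intro sum.cong refl) (simp add: field_simps)
  have m: "(\<Sum>w\<in>UNIV. lam w * ((power_balance \<xi> p r d l w + power_balance \<xi> p' r' d' l' w) / 2)) =
      ((\<Sum>w\<in>UNIV. lam w * power_balance \<xi> p r d l w)
       + (\<Sum>w\<in>UNIV. lam w * power_balance \<xi> p' r' d' l' w)) / 2"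
    unfolding sum.distrib[symmetric] sum_divide_distrib
    by (intro sum.cong refl) (simp add: field_simps)
  show ?thesis
    unfolding lagrangian_def social_welfare_def prod.case u c b s m by (simp add: field_simps)
qed

lemma lagrangian_maximizer_unique:
  fixes \<pi> :: "'w::finite \<Rightarrow> real"
  assumes "\<alpha> > 0" "\<beta> > 0" and \<pi>: "\<And>w. 0 < \<pi> w" and "convex \<O>" "convex \<K>"
    and x: "jointly_dispatchable \<O> \<K> x" and y: "jointly_dispatchable \<O> \<K> y"
    and max: "\<And>z. jointly_dispatchable \<O> \<K> z \<Longrightarrow>
      lagrangian \<alpha> \<beta> \<gamma> \<xi> \<pi> lam z \<le> lagrangian \<alpha> \<beta> \<gamma> \<xi> \<pi> lam x"
    and ge: "lagrangian \<alpha> \<beta> \<gamma> \<xi> \<pi> lam x \<le> lagrangian \<alpha> \<beta> \<gamma> \<xi> \<pi> lam y"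
  shows "y = x"
proof -
  obtain p r d l where x_eq: "x = (p, r, d, l)" by (cases x)
  obtain p' r' d' l' where y_eq: "y = (p', r', d', l')" by (cases y)
  let ?S = "\<lambda>w. \<pi> w * (\<alpha> * (r w - r' w)\<^sup>2 + \<beta> * (l w - l' w)\<^sup>2)"
  have "jointly_dispatchable \<O> \<K>
      ((p + p') / 2, \<lambda>w. (r w + r' w) / 2, (d + d') / 2, \<lambda>w. (l w + l' w) / 2)"
    using x y assms(4,5) unfolding x_eq y_eq jointly_dispatchable_def dispatchable_def
    by (auto intro: convex_midpoint_mem)
  \<comment> \<open>The midpoint cannot beat \<open>x\<close>, while the average of the two values
    is at least the value at \<open>x\<close>; this leaves no room for a positive gap.\<close>
  from max[OF this] ge
  have le: "\<alpha> * (p - p')\<^sup>2 + \<beta> * (d - d')\<^sup>2 + (\<Sum>w\<in>UNIV. ?S w) \<le> 0"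
    unfolding lagrangian_midpoint x_eq y_eq by argo
  have nonneg: "0 \<le> \<alpha> * a\<^sup>2" "0 \<le> \<beta> * a\<^sup>2" for a :: real
    using assms(1,2) by auto
  have S: "0 \<le> ?S w" for w
    using \<pi>[of w] nonneg by (simp add: less_imp_le)
  have "0 \<le> (\<Sum>w\<in>UNIV. ?S w)"
    using S by (rule sum_nonneg)
  with le nonneg[of "p - p'"] nonneg[of "d - d'"]
  have zero: "\<alpha> * (p - p')\<^sup>2 = 0" "\<beta> * (d - d')\<^sup>2 = 0" "(\<Sum>w\<in>UNIV. ?S w) = 0"
    by linarith+
  have "?S w = 0" for w
    using zero(3) S by (simp add: sum_nonneg_eq_0_iff)
  then have "\<alpha> * (r w - r' w)\<^sup>2 + \<beta> * (l w - l' w)\<^sup>2 = 0" for w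
    using \<pi>[of w] by (metis mult_eq_0_iff less_irrefl)
  then have "\<alpha> * (r w - r' w)\<^sup>2 = 0" "\<beta> * (l w - l' w)\<^sup>2 = 0" for w
    using nonneg by (simp_all add: add_nonneg_eq_0_iff)
  then have "r = r'" "l = l'"
    using assms(1,2) by auto
  with zero show ?thesis
    using assms(1,2) by (simp add: x_eq y_eq)
qed

section \<open>From optimal dual prices to the KKT conditions\<close>

text \<open>The Lagrangian is affine in a single price with the power balance as slope, which is why
  the balance takes the role of \<open>k\<close> in the directional argument.\<close>

lemma lagrangian_perturb_price:
  "lagrangian \<alpha> \<beta> \<gamma> \<xi> \<pi> (lam(w := lam w + t)) x =
    lagrangian \<alpha> \<beta> \<gamma> \<xi> \<pi> lam x + t * (case x of (p, r, d, l) \<Rightarrow> power_balance \<xi> p r d l w)"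
proof (cases x)
  case (fields p r d l)
  have "(\<Sum>v\<in>UNIV. (lam(w := lam w + t)) v * power_balance \<xi> p r d l v) =
      (\<Sum>v\<in>UNIV. lam v * power_balance \<xi> p r d l v + (if v = w then t * power_balance \<xi> p r d l v else 0))"
    by (intro sum.cong refl) (simp add: algebra_simps)
  also have "\<dots> = (\<Sum>v\<in>UNIV. lam v * power_balance \<xi> p r d l v) + t * power_balance \<xi> p r d l w"
    by (simp add: sum.distrib)
  finally show ?thesis
    by (simp add: fields lagrangian_def)
qed

text \<open>Moving one price at a time suffices: raising it yields feasibility of the balance, and
  lowering it where it is positive yields complementary slackness.\<close>

lemma dual_optimal_imp_kkt:
  fixes \<xi> \<pi> lam :: "'w::finite \<Rightarrow> real"
  assumes pos: "\<alpha> > 0" "\<beta> > 0" "\<And>w. 0 < \<pi> w"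
    and cvx: "convex \<O>" "convex \<K>"
    and cpt: "compact \<O>" "compact \<K>" "\<O> \<noteq> {}" "\<K> \<noteq> {}"
    and dual: "optimal_dual_prices \<alpha> \<beta> \<gamma> \<O> \<K> \<xi> \<pi> lam"
  obtains p r d l where "jointly_dispatchable \<O> \<K> (p, r, d, l)"
    "\<And>y. jointly_dispatchable \<O> \<K> y \<Longrightarrow>
      lagrangian \<alpha> \<beta> \<gamma> \<xi> \<pi> lam y \<le> lagrangian \<alpha> \<beta> \<gamma> \<xi> \<pi> lam (p, r, d, l)"
    "\<And>w. 0 \<le> power_balance \<xi> p r d l w"
    "\<And>w. lam w * power_balance \<xi> p r d l w = 0"
proof -
  let ?X = "Collect (jointly_dispatchable \<O> \<K>) :: (real \<times> ('w \<Rightarrow> real) \<times> real \<times> ('w \<Rightarrow> real)) set"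
  let ?L = "lagrangian \<alpha> \<beta> \<gamma> \<xi> \<pi>"
  let ?b = "\<lambda>w (p, r, d, l). power_balance \<xi> p r d l w"
  obtain x where x: "jointly_dispatchable \<O> \<K> x"
    "\<And>y. jointly_dispatchable \<O> \<K> y \<Longrightarrow> ?L lam y \<le> ?L lam x"
    "dual_function \<alpha> \<beta> \<gamma> \<O> \<K> \<xi> \<pi> lam = ?L lam x"
    by (rule lagrangian_attains_max[OF cpt, of \<alpha> \<beta> \<gamma> \<xi> \<pi> lam]) blast
  have lam: "0 \<le> lam w" for w
    using dual by (simp add: optimal_dual_prices_def is_arg_min_def)
  \<comment> \<open>The witness maximises the Lagrangian at the shifted price, so the right side is
    the dual value there and minimality of \<open>lam\<close> applies. The shift \<open>t\<close>
    may be negative.\<close>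
  have ascent: "\<exists>y\<in>?X. ?L lam x \<le> ?L lam y + t * ?b w y" if t: "0 \<le> lam w + t" for w t
  proof -
    let ?lam = "lam(w := lam w + t)"
    obtain y where y: "jointly_dispatchable \<O> \<K> y"
        "dual_function \<alpha> \<beta> \<gamma> \<O> \<K> \<xi> \<pi> ?lam = ?L ?lam y"
      by (rule lagrangian_attains_max[OF cpt, of \<alpha> \<beta> \<gamma> \<xi> \<pi> ?lam]) blast
    have "\<forall>v. 0 \<le> ?lam v"
      using lam t by simp
    then have "dual_function \<alpha> \<beta> \<gamma> \<O> \<K> \<xi> \<pi> lam \<le> dual_function \<alpha> \<beta> \<gamma> \<O> \<K> \<xi> \<pi> ?lam"
      using dual unfolding optimal_dual_prices_def is_arg_min_def by (meson not_le)
    then show ?thesis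
      using x(3) y by (auto simp only: lagrangian_perturb_price mem_Collect_eq)
  qed
  have unique: "y = x" if "y \<in> ?X" "?L lam x \<le> ?L lam y" for y
    using lagrangian_maximizer_unique[OF pos cvx x(1) _ x(2)] that by auto
  \<comment> \<open>The dual problem ranges over all nonnegative prices, so a price may be raised
    freely and the bound 1 on the step is arbitrary.\<close>
  have feasible: "0 \<le> ?b w x" for w
  proof (rule unique_maximizer_directional[where X = ?X and h = "?L lam" and \<delta> = 1])
    show "\<exists>y\<in>?X. ?L lam x \<le> ?L lam y + t * ?b w y" if "0 < t" for t
      using ascent lam[of w] that by simp
  qed (use x unique in \<open>auto intro: jointly_dispatchable_compact cpt continuous_on_lagrangian
      continuous_on_power_balance\<close>)
  \<comment> \<open>A positive price can be lowered by at most \<open>lam w\<close>; the direction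
    is reversed, hence the sign of \<open>k\<close>.\<close>
  have nonpos: "0 \<le> - ?b w x" if "lam w > 0" for w
  proof (rule unique_maximizer_directional[where X = ?X and h = "?L lam" and \<delta> = "lam w"
        and k = "\<lambda>x. - ?b w x"])
    show "\<exists>y\<in>?X. ?L lam x \<le> ?L lam y + t * - ?b w y" if "t \<le> lam w" for t
      using ascent[of w "- t"] that by simp
  qed (use x unique that in \<open>auto intro!: jointly_dispatchable_compact cpt continuous_on_lagrangian
      continuous_on_minus continuous_on_power_balance\<close>)
  have slack: "lam w * ?b w x = 0" for w
  proof (cases "lam w = 0")
    case False
    then have "?b w x = 0"
      using feasible[of w] nonpos[of w] lam[of w] by linarith
    then show ?thesis by simp
  qed simp
  obtain p r d l where "x = (p, r, d, l)" by (cases x)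
  with x feasible slack that show thesis by auto
qed

section \<open>From the KKT conditions to the market equilibrium\<close>

text \<open>The factor \<open>\<pi> w\<close> cancels against the price
  \<open>lam w / \<pi> w\<close>, so each payment enters at price \<open>lam w\<close>. Producer and
  consumer share no variables, so maximising the Lagrangian means maximising both objectives
  separately.\<close>

lemma lagrangian_decompose:
  fixes \<pi> :: "'w::finite \<Rightarrow> real"
  assumes "\<And>w. 0 < \<pi> w"
  shows "lagrangian \<alpha> \<beta> \<gamma> \<xi> \<pi> lam (p, r, d, l) =
    producer_objective \<alpha> \<pi> lam (p, r) + consumer_objective \<beta> \<gamma> \<pi> lam (d, l)
    + (\<Sum>w\<in>UNIV. lam w * \<xi> w)"
proof -
  have "\<pi> w \<noteq> 0" for w
    using assms[of w] by simp
  then have "\<pi> w * (utility \<beta> \<gamma> (l w) - cost \<alpha> (r w)) + lam w * power_balance \<xi> p r d l w =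
      \<pi> w * (lam w / \<pi> w * (p + r w) - cost \<alpha> (r w))
      + \<pi> w * (utility \<beta> \<gamma> (l w) - lam w / \<pi> w * (d + l w)) + lam w * \<xi> w" for w
    by (simp add: power_balance_def field_simps)
  then have "(\<Sum>w\<in>UNIV. \<pi> w * (utility \<beta> \<gamma> (l w) - cost \<alpha> (r w)))
      + (\<Sum>w\<in>UNIV. lam w * power_balance \<xi> p r d l w) =
      (\<Sum>w\<in>UNIV. \<pi> w * (lam w / \<pi> w * (p + r w) - cost \<alpha> (r w)))
      + (\<Sum>w\<in>UNIV. \<pi> w * (utility \<beta> \<gamma> (l w) - lam w / \<pi> w * (d + l w)))
      + (\<Sum>w\<in>UNIV. lam w * \<xi> w)"
    unfolding sum.distrib[symmetric] by (rule sum.cong[OF refl])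
  then show ?thesis
    by (simp add: lagrangian_def social_welfare_def producer_objective_def consumer_objective_def)
qed

text \<open>By slackness the price-setter earns 0 at \<open>lam\<close>, while a nonnegative balance
  makes every other admissible price earn at most 0. For the two agents the joint maximality is
  restricted to unilateral deviations.\<close>

lemma kkt_imp_equilibrium:
  fixes \<xi> \<pi> lam :: "'w::finite \<Rightarrow> real"
  assumes pos: "\<And>w. 0 < \<pi> w" and \<Lambda>: "\<Lambda> \<subseteq> {0..}" "\<And>w. lam w \<in> \<Lambda>"
    and x: "jointly_dispatchable \<O> \<K> (p, r, d, l)"
    and max: "\<And>y. jointly_dispatchable \<O> \<K> y \<Longrightarrow>
      lagrangian \<alpha> \<beta> \<gamma> \<xi> \<pi> lam y \<le> lagrangian \<alpha> \<beta> \<gamma> \<xi> \<pi> lam (p, r, d, l)"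
    and balance: "\<And>w. 0 \<le> power_balance \<xi> p r d l w"
    and slack: "\<And>w. lam w * power_balance \<xi> p r d l w = 0"
  shows "equilibrium_solution \<alpha> \<beta> \<gamma> \<O> \<K> \<Lambda> \<xi> \<pi> \<pi> (p, r, d, l) lam"
proof -
  have "0 \<le> m * power_balance \<xi> p r d l w" if "m \<in> \<Lambda>" for m w
    using that \<Lambda>(1) balance by auto
  then have "is_arg_max (\<lambda>m. - m * power_balance \<xi> p r d l w) (\<lambda>m. m \<in> \<Lambda>) (lam w)" for w
    using \<Lambda>(2) by (auto simp: is_arg_max_def not_less slack)
  \<comment> \<open>With \<open>(d, l)\<close> frozen, the consumer term and the constant cancel on
    both sides.\<close>
  moreover have "is_arg_max (producer_objective \<alpha> \<pi> lam) (dispatchable \<O>) (p, r)"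
    using x max[of "(_, _, d, l)"]
    by (auto simp: is_arg_max_def jointly_dispatchable_def not_less
        lagrangian_decompose[where \<pi> = \<pi>, OF pos])
  moreover have "is_arg_max (consumer_objective \<beta> \<gamma> \<pi> lam) (dispatchable \<K>) (d, l)"
    using x max[of "(p, r, _, _)"]
    by (auto simp: is_arg_max_def jointly_dispatchable_def not_less
        lagrangian_decompose[where \<pi> = \<pi>, OF pos])
  ultimately show ?thesis
    by (simp add: equilibrium_solution_def)
qed

text \<open>Weak duality, pointwise: nonnegative prices meet nonnegative balances.\<close>

lemma social_welfare_le_lagrangian:
  assumes "\<And>w. 0 \<le> lam w" "centralized_feasible \<O> \<K> \<xi> x"
  shows "social_welfare \<alpha> \<beta> \<gamma> \<pi> x \<le> lagrangian \<alpha> \<beta> \<gamma> \<xi> \<pi> lam x"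
  using assms by (auto simp: lagrangian_def centralized_feasible_def intro!: sum_nonneg)

text \<open>At the KKT point slackness makes Lagrangian and welfare agree, so weak duality shows
  that it solves the centralized problem. Any other solution would also maximise the Lagrangian, so
  uniqueness identifies it with the KKT point.\<close>

lemma dual_optimal_imp_equilibrium:
  fixes \<xi> \<pi> lam :: "'w::finite \<Rightarrow> real"
  assumes pos: "\<alpha> > 0" "\<beta> > 0" "\<And>w. 0 < \<pi> w"
    and cvx: "convex \<O>" "convex \<K>"
    and cpt: "compact \<O>" "compact \<K>" "\<O> \<noteq> {}" "\<K> \<noteq> {}"
    and \<Lambda>: "\<Lambda> \<subseteq> {0..}" "\<And>w. lam w \<in> \<Lambda>"
    and dual: "optimal_dual_prices \<alpha> \<beta> \<gamma> \<O> \<K> \<xi> \<pi> lam"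
  shows "\<exists>x. centralized_solution \<alpha> \<beta> \<gamma> \<O> \<K> \<xi> \<pi> x"
    and "centralized_solution \<alpha> \<beta> \<gamma> \<O> \<K> \<xi> \<pi> y \<Longrightarrow>
      equilibrium_solution \<alpha> \<beta> \<gamma> \<O> \<K> \<Lambda> \<xi> \<pi> \<pi> y lam"
proof -
  let ?L = "lagrangian \<alpha> \<beta> \<gamma> \<xi> \<pi> lam" and ?f = "social_welfare \<alpha> \<beta> \<gamma> \<pi>"
  obtain p r d l where x: "jointly_dispatchable \<O> \<K> (p, r, d, l)"
    "\<And>z. jointly_dispatchable \<O> \<K> z \<Longrightarrow> ?L z \<le> ?L (p, r, d, l)"
    "\<And>w. 0 \<le> power_balance \<xi> p r d l w" "\<And>w. lam w * power_balance \<xi> p r d l w = 0"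
    by (rule dual_optimal_imp_kkt[OF pos cvx cpt dual]) blast
  have lam: "0 \<le> lam w" for w
    using \<Lambda> by auto
  have feasible: "centralized_feasible \<O> \<K> \<xi> (p, r, d, l)"
    using x(1,3) by (simp add: centralized_feasible_def)
  have eq: "?L (p, r, d, l) = ?f (p, r, d, l)"
    by (simp add: lagrangian_def x(4))
  have joint: "jointly_dispatchable \<O> \<K> z" if "centralized_feasible \<O> \<K> \<xi> z" for z
    using that by (auto simp: centralized_feasible_def)
  have le: "?f z \<le> ?f (p, r, d, l)" if z: "centralized_feasible \<O> \<K> \<xi> z" for z
    using social_welfare_le_lagrangian[where lam = lam, OF lam z, of \<alpha> \<beta> \<gamma> \<pi>] x(2)[OF joint[OF z]] eq by simp
  then have "centralized_solution \<alpha> \<beta> \<gamma> \<O> \<K> \<xi> \<pi> (p, r, d, l)"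
    using feasible by (simp add: centralized_solution_def is_arg_max_def not_less)
  then show "\<exists>x. centralized_solution \<alpha> \<beta> \<gamma> \<O> \<K> \<xi> \<pi> x" ..
  assume "centralized_solution \<alpha> \<beta> \<gamma> \<O> \<K> \<xi> \<pi> y"
  then have y: "centralized_feasible \<O> \<K> \<xi> y" "?f (p, r, d, l) \<le> ?f y"
    using feasible by (auto simp: centralized_solution_def is_arg_max_def not_less)
  \<comment> \<open>The chain runs from the Lagrangian at the KKT point to its welfare, to the
    welfare of \<open>y\<close>, to the Lagrangian at \<open>y\<close>.\<close>
  have "?L (p, r, d, l) \<le> ?L y"
    using social_welfare_le_lagrangian[where lam = lam, OF lam y(1), of \<alpha> \<beta> \<gamma> \<pi>] y(2) eq by simp
  then have "y = (p, r, d, l)"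
    using lagrangian_maximizer_unique[OF pos cvx x(1) joint[OF y(1)] x(2)] by blast
  then show "equilibrium_solution \<alpha> \<beta> \<gamma> \<O> \<K> \<Lambda> \<xi> \<pi> \<pi> y lam"
    using kkt_imp_equilibrium[OF pos(3) \<Lambda> x] by simp
qed

theorem proposition2:
  fixes \<alpha> \<beta> \<gamma> :: real
    and \<O> \<K> :: "(real \<times> real) set"
    and \<Lambda> :: "real set"
    and \<xi> \<pi>mo \<pi>p \<pi>c :: "'w::finite \<Rightarrow> real"
  assumes "\<alpha> > 0" and "\<beta> > 0" and "\<gamma> > 0"
    and "\<O> \<noteq> {}" and "convex \<O>" and "compact \<O>"
    and "\<K> \<noteq> {}" and "convex \<K>" and "compact \<K>"
    and "convex \<Lambda>" and "compact \<Lambda>" and "\<Lambda> \<subseteq> {0..}" and "0 \<in> \<Lambda>"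
    and "probability_vector \<pi>mo" and "probability_vector \<pi>p" and "probability_vector \<pi>c"
    and dual_prices_exist:
      "\<exists>lam. optimal_dual_prices \<alpha> \<beta> \<gamma> \<O> \<K> \<xi> \<pi>mo lam \<and> (\<forall>w. lam w \<in> \<Lambda>)"
    and "\<forall>w. \<pi>mo w = \<pi>p w \<and> \<pi>p w = \<pi>c w"
  shows "(\<exists>x. centralized_solution \<alpha> \<beta> \<gamma> \<O> \<K> \<xi> \<pi>mo x) \<and>
    (\<forall>x. centralized_solution \<alpha> \<beta> \<gamma> \<O> \<K> \<xi> \<pi>mo x \<longrightarrow>
       (\<exists>lamt. equilibrium_solution \<alpha> \<beta> \<gamma> \<O> \<K> \<Lambda> \<xi> \<pi>p \<pi>c x lamt) \<and>
       (\<forall>lam. optimal_dual_prices \<alpha> \<beta> \<gamma> \<O> \<K> \<xi> \<pi>mo lam \<and> (\<forall>w. lam w \<in> \<Lambda>) \<longrightarrow>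
          (\<exists>lamt. equilibrium_solution \<alpha> \<beta> \<gamma> \<O> \<K> \<Lambda> \<xi> \<pi>p \<pi>c x lamt \<and>
                  (\<forall>w. lamt w = lam w))))"
proof -
  \<comment> \<open>Common beliefs let the operator's Lagrangian split into exactly the two agents'
    objectives.\<close>
  have \<pi>: "\<pi>p = \<pi>mo" "\<pi>c = \<pi>mo"
    using assms(18) by auto
  have pos: "0 < \<pi>mo w" for w
    using assms(14) by (simp add: probability_vector_def)
  \<comment> \<open>The prices stay schematic: the fact serves both the prices from
    \<open>dual_prices_exist\<close> and every optimal dual price vector in
    \<open>\<Lambda>\<close>, with \<open>lamt\<close> taken to be that vector.\<close>
  note result = dual_optimal_imp_equilibrium[where \<pi> = \<pi>mo,
      OF assms(1,2) pos assms(5,8,6,9,4,7,12)]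
  obtain lam where lam: "optimal_dual_prices \<alpha> \<beta> \<gamma> \<O> \<K> \<xi> \<pi>mo lam" "\<And>w. lam w \<in> \<Lambda>"
    using dual_prices_exist by blast
  show ?thesis
    unfolding \<pi> using result(1)[OF lam(2,1)] result(2) lam by blast
qed

end
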